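(* Let $\mathbb K$ be a commutative unital ring, $\mathbb B$ an associative unital $\mathbb K$-algebra, $W$ a right $\mathbb B$-module, $\mathcal X$ the set of all $\mathbb B$-submodules of $W$, and $\Gamma:\mathcal X^5\to\mathcal X$, $$\Gamma(x,a,y,b,z)=\{\omega\in W\mid \exists \xi\in x,\alpha\in a,\eta\in y,\beta\in b,\zeta\in z:\ \omega=\zeta+\alpha=\alpha+\eta+\beta=\xi+\beta\}.$$ Then $\Gamma$ takes the following diagonal values. (1) (Diagonal $x=y$) For all $x,a,b,z\in\mathcal X$: $\Gamma(x,a,x,b,z)=(z\lor(x\land a))\land(b\lor x)$. In particular, for all $x,a,b,z$: (i) $\Gamma(x,a,x,b,x)=x$; (ii) $\Gamma(x,x,x,b,z)=(z\lor x)\land(b\lor x)$; (iii) $\Gamma(x,x,x,z,z)=z\lor x$; (iv) $\Gamma(x,a,x,x,z)=(z\lor(x\land a))\land x$; (v) $\Gamma(x,a,x,x,a)=a\land x$; (vi) $\Gamma(x,a,x,b,a)=a\land(b\lor x)$; (vii) $\Gamma(x,a,x,a,z)=(z\lor(x\land a))\land(x\lor a)$; (viii) $\Gamma(x,a,x,z,z)=z\lor(x\land a)$. (2) (Diagonal $a=z$) For all $x,a,y,b\in\mathcal X$: $\Gamma(x,a,y,b,a)=a\land(b\lor(x\land(y\lor a)))$. In particular, for all $x,a,y\in\mathcal X$: $\Gamma(x,a,y,x,a)=a\land x$. (3) (Diagonal $b=z$) For all $x,a,y,b\in\mathcal X$: $\Gamma(x,a,y,b,b)=b\lor(a\land(x\lor(y\land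 b)))$. In particular, for all $a,y,b\in\mathcal X$: $\Gamma(a,a,y,b,b)=b\lor a$; and for all $x,a,y\in\mathcal X$: $\Gamma(x,a,y,a,a)=a$.
   Context: For submodules $x,y$ of $W$: $x\land y=x\cap y$ and $x\lor y=x+y$. *)

theory Defs
  imports "HOL-Algebra.Module" "HOL-Algebra.AbelCoset"
begin

(* The library locale algebra requires the algebra to be a commutative ring, and the library
   locale module requires a commutative ring of scalars, hence the two locales below.
   As everywhere in HOL-Algebra, zero rings are allowed. *)

locale associative_algebra = module K B + B?: ring B for K (structure) and B (structure) +
  assumes smult_mult_left:
      "\<lbrakk>k \<in> carrier K; b \<in> carrier B; c \<in> carrier B\<rbrakk> \<Longrightarrow>
        (k \<odot>\<^bsub>B\<^esub> b) \<otimes>\<^bsub>B\<^esub> c = k \<odot>\<^bsub>B\<^esub> (b \<otimes>\<^bsub>B\<^esub> c)"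
    and smult_mult_right:
      "\<lbrakk>k \<in> carrier K; b \<in> carrier B; c \<in> carrier B\<rbrakk> \<Longrightarrow>
        b \<otimes>\<^bsub>B\<^esub> (k \<odot>\<^bsub>B\<^esub> c) = k \<odot>\<^bsub>B\<^esub> (b \<otimes>\<^bsub>B\<^esub> c)"

(* The record field smult of W, written with the scalar first, holds the right action:
   b \<odot> w stands for w b.  This is why the associativity law reverses the order of b and c. *)

locale right_module = B?: ring B + W?: abelian_group W for B (structure) and W (structure) +
  assumes ract_closed:
      "\<lbrakk>b \<in> carrier B; w \<in> carrier W\<rbrakk> \<Longrightarrow> b \<odot>\<^bsub>W\<^esub> w \<in> carrier W"
    and ract_add_scalar:
      "\<lbrakk>b \<in> carrier B; c \<in> carrier B; w \<in> carrier W\<rbrakk> \<Longrightarrow>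
        (b \<oplus>\<^bsub>B\<^esub> c) \<odot>\<^bsub>W\<^esub> w = b \<odot>\<^bsub>W\<^esub> w \<oplus>\<^bsub>W\<^esub> c \<odot>\<^bsub>W\<^esub> w"
    and ract_add_vector:
      "\<lbrakk>b \<in> carrier B; v \<in> carrier W; w \<in> carrier W\<rbrakk> \<Longrightarrow>
        b \<odot>\<^bsub>W\<^esub> (v \<oplus>\<^bsub>W\<^esub> w) = b \<odot>\<^bsub>W\<^esub> v \<oplus>\<^bsub>W\<^esub> b \<odot>\<^bsub>W\<^esub> w"
    and ract_assoc:
      "\<lbrakk>b \<in> carrier B; c \<in> carrier B; w \<in> carrier W\<rbrakk> \<Longrightarrow>
        (b \<otimes>\<^bsub>B\<^esub> c) \<odot>\<^bsub>W\<^esub> w = c \<odot>\<^bsub>W\<^esub> (b \<odot>\<^bsub>W\<^esub> w)"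
    and ract_one:
      "w \<in> carrier W \<Longrightarrow> \<one>\<^bsub>B\<^esub> \<odot>\<^bsub>W\<^esub> w = w"

(* The library predicate submodule only asks for an additive subgroup stable under smult,
   so it applies verbatim to right modules. *)

definition submodules :: "('b, 'm) ring_scheme \<Rightarrow> ('b, 'w, 'n) module_scheme \<Rightarrow> 'w set set" where
  "submodules B W = {H. submodule H B W}"

definition Gamma :: "('b, 'w, 'n) module_scheme \<Rightarrow>
    'w set \<Rightarrow> 'w set \<Rightarrow> 'w set \<Rightarrow> 'w set \<Rightarrow> 'w set \<Rightarrow> 'w set" where
  "Gamma W x a y b z =
     {\<omega> \<in> carrier W. \<exists>\<xi>\<in>x. \<exists>\<alpha>\<in>a. \<exists>\<eta>\<in>y. \<exists>\<beta>\<in>b. \<exists>\<zeta>\<in>z.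
        \<omega> = \<zeta> \<oplus>\<^bsub>W\<^esub> \<alpha> \<and> \<omega> = \<alpha> \<oplus>\<^bsub>W\<^esub> \<eta> \<oplus>\<^bsub>W\<^esub> \<beta> \<and> \<omega> = \<xi> \<oplus>\<^bsub>W\<^esub> \<beta>}"

context right_module
begin

lemma submodulesD:
  assumes "H \<in> submodules B W"
  shows "H \<subseteq> carrier W" "\<zero>\<^bsub>W\<^esub> \<in> H"
    "\<And>u v. \<lbrakk>u \<in> H; v \<in> H\<rbrakk> \<Longrightarrow> u \<oplus>\<^bsub>W\<^esub> v \<in> H"
    "\<And>u. u \<in> H \<Longrightarrow> \<ominus>\<^bsub>W\<^esub> u \<in> H"
    "\<And>c u. \<lbrakk>c \<in> carrier B; u \<in> H\<rbrakk> \<Longrightarrow> c \<odot>\<^bsub>W\<^esub> u \<in> H"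
proof -
  interpret H: submodule H B W
    using assms by (simp add: submodules_def)
  show "H \<subseteq> carrier W" "\<zero>\<^bsub>W\<^esub> \<in> H"
    "\<And>u v. \<lbrakk>u \<in> H; v \<in> H\<rbrakk> \<Longrightarrow> u \<oplus>\<^bsub>W\<^esub> v \<in> H"
    "\<And>u. u \<in> H \<Longrightarrow> \<ominus>\<^bsub>W\<^esub> u \<in> H"
    "\<And>c u. \<lbrakk>c \<in> carrier B; u \<in> H\<rbrakk> \<Longrightarrow> c \<odot>\<^bsub>W\<^esub> u \<in> H"
    using H.subset H.one_closed H.m_closed H.m_inv_closed H.smult_closed
    by (simp_all add: a_inv_def)
qed

lemma submodulesI:
  assumes "H \<subseteq> carrier W" "\<zero>\<^bsub>W\<^esub> \<in> H"
    and "\<And>u v. \<lbrakk>u \<in> H; v \<in> H\<rbrakk> \<Longrightarrow> u \<oplus>\<^bsub>W\<^esub> v \<in> H"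
    and "\<And>u. u \<in> H \<Longrightarrow> \<ominus>\<^bsub>W\<^esub> u \<in> H"
    and "\<And>c u. \<lbrakk>c \<in> carrier B; u \<in> H\<rbrakk> \<Longrightarrow> c \<odot>\<^bsub>W\<^esub> u \<in> H"
  shows "H \<in> submodules B W"
  unfolding submodules_def mem_Collect_eq
  using assms by (intro submodule.intro subgroup.intro submodule_axioms.intro) (simp_all add: a_inv_def)

lemma Gamma_in_submodules:
  assumes x: "x \<in> submodules B W" and a: "a \<in> submodules B W" and y: "y \<in> submodules B W"
    and b: "b \<in> submodules B W" and z: "z \<in> submodules B W"
  shows "Gamma W x a y b z \<in> submodules B W"
proof (rule submodulesI)
  note subs = x a y b z
  note sub = subs[THEN submodulesD(1), THEN subsetD]
  note zero = subs[THEN submodulesD(2)]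
  note add = subs[THEN submodulesD(3)]
  note neg = subs[THEN submodulesD(4)]
  note act = subs[THEN submodulesD(5)]
  have GI: "\<omega> \<in> Gamma W x a y b z"
    if "\<xi> \<in> x" "\<alpha> \<in> a" "\<eta> \<in> y" "\<beta> \<in> b" "\<zeta> \<in> z" "\<omega> = \<zeta> \<oplus>\<^bsub>W\<^esub> \<alpha>"
      "\<omega> = \<alpha> \<oplus>\<^bsub>W\<^esub> \<eta> \<oplus>\<^bsub>W\<^esub> \<beta>" "\<omega> = \<xi> \<oplus>\<^bsub>W\<^esub> \<beta>" for \<omega> \<xi> \<alpha> \<eta> \<beta> \<zeta>
  proof -
    have "\<omega> \<in> carrier W" using that(2,5,6) sub by simp
    then show ?thesis
      unfolding Gamma_def mem_Collect_eq using that(6-8)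
      by (intro conjI bexI[OF _ that(1)] bexI[OF _ that(2)] bexI[OF _ that(3)] bexI[OF _ that(4)]
          bexI[OF _ that(5)])
  qed
  show "Gamma W x a y b z \<subseteq> carrier W"
    unfolding Gamma_def by blast
  show "\<zero>\<^bsub>W\<^esub> \<in> Gamma W x a y b z"
    by (rule GI[of "\<zero>\<^bsub>W\<^esub>" "\<zero>\<^bsub>W\<^esub>" "\<zero>\<^bsub>W\<^esub>" "\<zero>\<^bsub>W\<^esub>" "\<zero>\<^bsub>W\<^esub>"]) (simp_all add: zero)
  have GE: thesis
    if G: "\<omega> \<in> Gamma W x a y b z"
      and *: "\<And>\<xi> \<alpha> \<eta> \<beta> \<zeta>. \<lbrakk>\<xi> \<in> x; \<alpha> \<in> a; \<eta> \<in> y; \<beta> \<in> b; \<zeta> \<in> z; \<omega> = \<zeta> \<oplus>\<^bsub>W\<^esub> \<alpha>;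
        \<omega> = \<alpha> \<oplus>\<^bsub>W\<^esub> \<eta> \<oplus>\<^bsub>W\<^esub> \<beta>; \<omega> = \<xi> \<oplus>\<^bsub>W\<^esub> \<beta>\<rbrakk> \<Longrightarrow> thesis" for \<omega> thesis
    using G unfolding Gamma_def mem_Collect_eq by (elim conjE bexE) (rule *)
  show "u \<oplus>\<^bsub>W\<^esub> v \<in> Gamma W x a y b z"
    if u: "u \<in> Gamma W x a y b z" and v: "v \<in> Gamma W x a y b z" for u v
  proof -
    obtain \<xi> \<alpha> \<eta> \<beta> \<zeta> where 1: "\<xi> \<in> x" "\<alpha> \<in> a" "\<eta> \<in> y" "\<beta> \<in> b" "\<zeta> \<in> z"
      and e: "u = \<zeta> \<oplus>\<^bsub>W\<^esub> \<alpha>" "u = \<alpha> \<oplus>\<^bsub>W\<^esub> \<eta> \<oplus>\<^bsub>W\<^esub> \<beta>" "u = \<xi> \<oplus>\<^bsub>W\<^esub> \<beta>"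
      by (rule GE[OF u])
    note c = 1(1)[THEN sub(1)] 1(2)[THEN sub(2)] 1(3)[THEN sub(3)] 1(4)[THEN sub(4)] 1(5)[THEN sub(5)]
    obtain \<xi>' \<alpha>' \<eta>' \<beta>' \<zeta>' where 2: "\<xi>' \<in> x" "\<alpha>' \<in> a" "\<eta>' \<in> y" "\<beta>' \<in> b" "\<zeta>' \<in> z"
      and e': "v = \<zeta>' \<oplus>\<^bsub>W\<^esub> \<alpha>'" "v = \<alpha>' \<oplus>\<^bsub>W\<^esub> \<eta>' \<oplus>\<^bsub>W\<^esub> \<beta>'" "v = \<xi>' \<oplus>\<^bsub>W\<^esub> \<beta>'"
      by (rule GE[OF v])
    note c' = 2(1)[THEN sub(1)] 2(2)[THEN sub(2)] 2(3)[THEN sub(3)] 2(4)[THEN sub(4)] 2(5)[THEN sub(5)]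
    have "u \<oplus>\<^bsub>W\<^esub> v = (\<zeta> \<oplus>\<^bsub>W\<^esub> \<zeta>') \<oplus>\<^bsub>W\<^esub> (\<alpha> \<oplus>\<^bsub>W\<^esub> \<alpha>')"
      unfolding e(1) e'(1) using c c' by (simp add: W.a_ac)
    moreover have "u \<oplus>\<^bsub>W\<^esub> v = (\<alpha> \<oplus>\<^bsub>W\<^esub> \<alpha>') \<oplus>\<^bsub>W\<^esub> (\<eta> \<oplus>\<^bsub>W\<^esub> \<eta>') \<oplus>\<^bsub>W\<^esub> (\<beta> \<oplus>\<^bsub>W\<^esub> \<beta>')"
      unfolding e(2) e'(2) using c c' by (simp add: W.a_ac)
    moreover have "u \<oplus>\<^bsub>W\<^esub> v = (\<xi> \<oplus>\<^bsub>W\<^esub> \<xi>') \<oplus>\<^bsub>W\<^esub> (\<beta> \<oplus>\<^bsub>W\<^esub> \<beta>')"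
      unfolding e(3) e'(3) using c c' by (simp add: W.a_ac)
    ultimately show ?thesis
      by (intro GI[of "\<xi> \<oplus>\<^bsub>W\<^esub> \<xi>'" "\<alpha> \<oplus>\<^bsub>W\<^esub> \<alpha>'" "\<eta> \<oplus>\<^bsub>W\<^esub> \<eta>'" "\<beta> \<oplus>\<^bsub>W\<^esub> \<beta>'" "\<zeta> \<oplus>\<^bsub>W\<^esub> \<zeta>'"])
        (simp_all add: 1 2 add)
  qed
  show "\<ominus>\<^bsub>W\<^esub> u \<in> Gamma W x a y b z" if u: "u \<in> Gamma W x a y b z" for u
  proof -
    obtain \<xi> \<alpha> \<eta> \<beta> \<zeta> where 1: "\<xi> \<in> x" "\<alpha> \<in> a" "\<eta> \<in> y" "\<beta> \<in> b" "\<zeta> \<in> z"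
      and e: "u = \<zeta> \<oplus>\<^bsub>W\<^esub> \<alpha>" "u = \<alpha> \<oplus>\<^bsub>W\<^esub> \<eta> \<oplus>\<^bsub>W\<^esub> \<beta>" "u = \<xi> \<oplus>\<^bsub>W\<^esub> \<beta>"
      by (rule GE[OF u])
    note c = 1(1)[THEN sub(1)] 1(2)[THEN sub(2)] 1(3)[THEN sub(3)] 1(4)[THEN sub(4)] 1(5)[THEN sub(5)]
    have "\<ominus>\<^bsub>W\<^esub> u = \<ominus>\<^bsub>W\<^esub> \<zeta> \<oplus>\<^bsub>W\<^esub> \<ominus>\<^bsub>W\<^esub> \<alpha>"
      unfolding e(1) using c by (simp add: W.minus_add)
    moreover have "\<ominus>\<^bsub>W\<^esub> u = \<ominus>\<^bsub>W\<^esub> \<alpha> \<oplus>\<^bsub>W\<^esub> \<ominus>\<^bsub>W\<^esub> \<eta> \<oplus>\<^bsub>W\<^esub> \<ominus>\<^bsub>W\<^esub> \<beta>"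
      unfolding e(2) using c by (simp add: W.minus_add)
    moreover have "\<ominus>\<^bsub>W\<^esub> u = \<ominus>\<^bsub>W\<^esub> \<xi> \<oplus>\<^bsub>W\<^esub> \<ominus>\<^bsub>W\<^esub> \<beta>"
      unfolding e(3) using c by (simp add: W.minus_add)
    ultimately show ?thesis
      by (intro GI[of "\<ominus>\<^bsub>W\<^esub> \<xi>" "\<ominus>\<^bsub>W\<^esub> \<alpha>" "\<ominus>\<^bsub>W\<^esub> \<eta>" "\<ominus>\<^bsub>W\<^esub> \<beta>" "\<ominus>\<^bsub>W\<^esub> \<zeta>"])
        (simp_all add: 1 neg)
  qed
  show "k \<odot>\<^bsub>W\<^esub> u \<in> Gamma W x a y b z"
    if k: "k \<in> carrier B" and u: "u \<in> Gamma W x a y b z" for k u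
  proof -
    obtain \<xi> \<alpha> \<eta> \<beta> \<zeta> where 1: "\<xi> \<in> x" "\<alpha> \<in> a" "\<eta> \<in> y" "\<beta> \<in> b" "\<zeta> \<in> z"
      and e: "u = \<zeta> \<oplus>\<^bsub>W\<^esub> \<alpha>" "u = \<alpha> \<oplus>\<^bsub>W\<^esub> \<eta> \<oplus>\<^bsub>W\<^esub> \<beta>" "u = \<xi> \<oplus>\<^bsub>W\<^esub> \<beta>"
      by (rule GE[OF u])
    note c = 1(1)[THEN sub(1)] 1(2)[THEN sub(2)] 1(3)[THEN sub(3)] 1(4)[THEN sub(4)] 1(5)[THEN sub(5)]
    have "k \<odot>\<^bsub>W\<^esub> u = k \<odot>\<^bsub>W\<^esub> \<zeta> \<oplus>\<^bsub>W\<^esub> k \<odot>\<^bsub>W\<^esub> \<alpha>"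
      unfolding e(1) using c k by (simp add: ract_add_vector)
    moreover have "k \<odot>\<^bsub>W\<^esub> u = k \<odot>\<^bsub>W\<^esub> \<alpha> \<oplus>\<^bsub>W\<^esub> k \<odot>\<^bsub>W\<^esub> \<eta> \<oplus>\<^bsub>W\<^esub> k \<odot>\<^bsub>W\<^esub> \<beta>"
      unfolding e(2) using c k by (simp add: ract_add_vector)
    moreover have "k \<odot>\<^bsub>W\<^esub> u = k \<odot>\<^bsub>W\<^esub> \<xi> \<oplus>\<^bsub>W\<^esub> k \<odot>\<^bsub>W\<^esub> \<beta>"
      unfolding e(3) using c k by (simp add: ract_add_vector)
    ultimately show ?thesis
      by (intro GI[of "k \<odot>\<^bsub>W\<^esub> \<xi>" "k \<odot>\<^bsub>W\<^esub> \<alpha>" "k \<odot>\<^bsub>W\<^esub> \<eta>" "k \<odot>\<^bsub>W\<^esub> \<beta>" "k \<odot>\<^bsub>W\<^esub> \<zeta>"])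
        (simp_all add: 1 k act)
  qed
qed

end

end

(* Comparing the three expressions for omega gives xi = alpha + eta and zeta = eta + beta.
   Each diagonal then says which intersection one of the five summands falls into
   (alpha in x \<inter> a if x = y, xi in x \<inter> (y + a) if a = z, eta in y \<inter> b if b = z),
   and the special cases are absorption in the lattice of submodules. *)

theory Submission
  imports Defs
begin

context right_module
begin

section \<open>Sums and intersections of submodules\<close>

lemma mem_set_add_iff: "w \<in> H <+>\<^bsub>W\<^esub> L \<longleftrightarrow> (\<exists>h\<in>H. \<exists>l\<in>L. w = h \<oplus>\<^bsub>W\<^esub> l)"
  by (auto simp: set_add_def')

lemma submodules_Int:
  assumes "H \<in> submodules B W" "L \<in> submodules B W"
  shows "H \<inter> L \<in> submodules B W"
  using assms[THEN submodulesD(1)] assms[THEN submodulesD(2)] assms[THEN submodulesD(3)]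
    assms[THEN submodulesD(4)] assms[THEN submodulesD(5)]
  by (intro submodulesI) auto

lemma subset_set_add_left:
  assumes "H \<in> submodules B W" "L \<in> submodules B W"
  shows "H \<subseteq> H <+>\<^bsub>W\<^esub> L"
proof
  fix h assume h: "h \<in> H"
  then have "h = h \<oplus>\<^bsub>W\<^esub> \<zero>\<^bsub>W\<^esub>"
    using submodulesD(1)[OF assms(1)] by auto
  then show "h \<in> H <+>\<^bsub>W\<^esub> L"
    using h submodulesD(2)[OF assms(2)] unfolding mem_set_add_iff by blast
qed

lemma set_add_commute:
  assumes "H \<in> submodules B W" "L \<in> submodules B W"
  shows "H <+>\<^bsub>W\<^esub> L = L <+>\<^bsub>W\<^esub> H"
proof -
  have "h \<oplus>\<^bsub>W\<^esub> l = l \<oplus>\<^bsub>W\<^esub> h" if "h \<in> H" "l \<in> L" for h l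
    using that assms[THEN submodulesD(1)] by (intro W.a_comm) auto
  then show ?thesis
    unfolding set_eq_iff mem_set_add_iff by metis
qed

lemma set_add_mono:
  assumes "H \<subseteq> H'" "L \<subseteq> L'"
  shows "H <+>\<^bsub>W\<^esub> L \<subseteq> H' <+>\<^bsub>W\<^esub> L'"
  using assms unfolding mem_set_add_iff subset_iff by blast

text \<open>Closure of \<open>H\<close> under addition leaves no room for elements of
  \<open>L\<close> to enlarge it. This one law serves as a conditional rewrite rule in the special
  cases, with the larger summand always on the left.\<close>

lemma set_add_absorb:
  assumes "H \<in> submodules B W" "L \<in> submodules B W" "L \<subseteq> H"
  shows "H <+>\<^bsub>W\<^esub> L = H"
proof
  show "H <+>\<^bsub>W\<^esub> L \<subseteq> H"
    using submodulesD(3)[OF assms(1)] assms(3) unfolding mem_set_add_iff subset_iff by blast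
qed (rule subset_set_add_left[OF assms(1,2)])

text \<open>Each operation of \<open>W\<close> distributes over the two summands, by commutativity
  in the case of addition. It is needed so that absorption applies to nested terms such as x
  \<inter> (y + a).\<close>

lemma submodules_set_add:
  assumes "H \<in> submodules B W" "L \<in> submodules B W"
  shows "H <+>\<^bsub>W\<^esub> L \<in> submodules B W"
proof -
  note sub = assms[THEN submodulesD(1), THEN subsetD]
  show ?thesis
  proof (rule submodulesI)
    show "H <+>\<^bsub>W\<^esub> L \<subseteq> carrier W"
      using sub by (auto simp: mem_set_add_iff)
    show "\<zero>\<^bsub>W\<^esub> \<in> H <+>\<^bsub>W\<^esub> L"
      using subset_set_add_left[OF assms] submodulesD(2)[OF assms(1)] by blast
  next
    fix u v assume "u \<in> H <+>\<^bsub>W\<^esub> L" "v \<in> H <+>\<^bsub>W\<^esub> L"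
    then obtain h l h' l' where hl: "h \<in> H" "l \<in> L" "u = h \<oplus>\<^bsub>W\<^esub> l" "h' \<in> H" "l' \<in> L" "v = h' \<oplus>\<^bsub>W\<^esub> l'"
      by (auto simp: mem_set_add_iff)
    then have "u \<oplus>\<^bsub>W\<^esub> v = (h \<oplus>\<^bsub>W\<^esub> h') \<oplus>\<^bsub>W\<^esub> (l \<oplus>\<^bsub>W\<^esub> l')"
      using sub by (simp add: W.a_ac)
    then show "u \<oplus>\<^bsub>W\<^esub> v \<in> H <+>\<^bsub>W\<^esub> L"
      using hl assms[THEN submodulesD(3)] unfolding mem_set_add_iff by blast
  next
    fix u assume "u \<in> H <+>\<^bsub>W\<^esub> L"
    then obtain h l where hl: "h \<in> H" "l \<in> L" "u = h \<oplus>\<^bsub>W\<^esub> l"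
      by (auto simp: mem_set_add_iff)
    then have "\<ominus>\<^bsub>W\<^esub> u = \<ominus>\<^bsub>W\<^esub> h \<oplus>\<^bsub>W\<^esub> \<ominus>\<^bsub>W\<^esub> l"
      using sub by (simp add: W.minus_add)
    then show "\<ominus>\<^bsub>W\<^esub> u \<in> H <+>\<^bsub>W\<^esub> L"
      using hl assms[THEN submodulesD(4)] unfolding mem_set_add_iff by blast
  next
    fix c u assume c: "c \<in> carrier B" and "u \<in> H <+>\<^bsub>W\<^esub> L"
    then obtain h l where hl: "h \<in> H" "l \<in> L" "u = h \<oplus>\<^bsub>W\<^esub> l"
      by (auto simp: mem_set_add_iff)
    then have "c \<odot>\<^bsub>W\<^esub> u = c \<odot>\<^bsub>W\<^esub> h \<oplus>\<^bsub>W\<^esub> c \<odot>\<^bsub>W\<^esub> l"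
      using sub c by (simp add: ract_add_vector)
    then show "c \<odot>\<^bsub>W\<^esub> u \<in> H <+>\<^bsub>W\<^esub> L"
      using hl c assms[THEN submodulesD(5)] unfolding mem_set_add_iff by blast
  qed
qed

section \<open>Membership in \<open>Gamma\<close> with three free summands\<close>

text \<open>Since \<xi> and \<zeta> are determined by \<alpha>, \<eta> and \<beta>, they can be
  eliminated; what remains of them are the two conditions that \<alpha> + \<eta> lies in
  \<open>x\<close> and \<eta> + \<beta> in \<open>z\<close>.\<close>

lemma mem_Gamma_iff:
  assumes x: "x \<in> submodules B W" and a: "a \<in> submodules B W" and y: "y \<in> submodules B W"
    and b: "b \<in> submodules B W" and z: "z \<in> submodules B W"
  shows "\<omega> \<in> Gamma W x a y b z \<longleftrightarrow>
    (\<exists>\<alpha>\<in>a. \<exists>\<eta>\<in>y. \<exists>\<beta>\<in>b. \<alpha> \<oplus>\<^bsub>W\<^esub> \<eta> \<in> x \<and> \<eta> \<oplus>\<^bsub>W\<^esub> \<beta> \<in> z \<and> \<omega> = \<alpha> \<oplus>\<^bsub>W\<^esub> \<eta> \<oplus>\<^bsub>W\<^esub> \<beta>)"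
    (is "_ \<longleftrightarrow> ?R")
proof
  note sub = assms[THEN submodulesD(1), THEN subsetD]
  assume "\<omega> \<in> Gamma W x a y b z"
  then obtain \<xi> \<alpha> \<eta> \<beta> \<zeta> where 1: "\<xi> \<in> x" "\<alpha> \<in> a" "\<eta> \<in> y" "\<beta> \<in> b" "\<zeta> \<in> z"
    and e: "\<omega> = \<zeta> \<oplus>\<^bsub>W\<^esub> \<alpha>" "\<omega> = \<alpha> \<oplus>\<^bsub>W\<^esub> \<eta> \<oplus>\<^bsub>W\<^esub> \<beta>" "\<omega> = \<xi> \<oplus>\<^bsub>W\<^esub> \<beta>"
    unfolding Gamma_def by blast
  note c = 1(1)[THEN sub(1)] 1(2)[THEN sub(2)] 1(3)[THEN sub(3)] 1(4)[THEN sub(4)] 1(5)[THEN sub(5)]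
  have "\<alpha> \<oplus>\<^bsub>W\<^esub> \<eta> \<oplus>\<^bsub>W\<^esub> \<beta> = \<xi> \<oplus>\<^bsub>W\<^esub> \<beta>"
    using e by simp
  then have "\<alpha> \<oplus>\<^bsub>W\<^esub> \<eta> = \<xi>"
    using c by simp
  \<comment> \<open>Both expressions are reordered to begin with \<alpha>, so that left cancellation
    yields \<zeta>.\<close>
  moreover have "\<alpha> \<oplus>\<^bsub>W\<^esub> (\<eta> \<oplus>\<^bsub>W\<^esub> \<beta>) = \<alpha> \<oplus>\<^bsub>W\<^esub> \<zeta>"
    using e c by (simp add: W.a_ac)
  then have "\<eta> \<oplus>\<^bsub>W\<^esub> \<beta> = \<zeta>"
    using c by simp
  ultimately show ?R
    using 1 e by blast
next
  note sub = assms[THEN submodulesD(1), THEN subsetD]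
  assume ?R
  then obtain \<alpha> \<eta> \<beta> where 1: "\<alpha> \<in> a" "\<eta> \<in> y" "\<beta> \<in> b" "\<alpha> \<oplus>\<^bsub>W\<^esub> \<eta> \<in> x" "\<eta> \<oplus>\<^bsub>W\<^esub> \<beta> \<in> z"
    and e: "\<omega> = \<alpha> \<oplus>\<^bsub>W\<^esub> \<eta> \<oplus>\<^bsub>W\<^esub> \<beta>" by blast
  note c = 1(1)[THEN sub(2)] 1(2)[THEN sub(3)] 1(3)[THEN sub(4)]
  have "\<omega> = (\<eta> \<oplus>\<^bsub>W\<^esub> \<beta>) \<oplus>\<^bsub>W\<^esub> \<alpha>" "\<omega> \<in> carrier W"
    using c e by (simp_all add: W.a_ac)
  then show "\<omega> \<in> Gamma W x a y b z"
    unfolding Gamma_def using 1 e by blast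
qed

section \<open>The three diagonal formulas\<close>

text \<open>With \<eta> and \<alpha> + \<eta> both in \<open>x\<close>, also \<alpha> lies in
  \<open>x\<close>, which gives the two decompositions (\<eta> + \<beta>) + \<alpha> and \<beta> +
  (\<alpha> + \<eta>) of \<omega>. Conversely, two such decompositions \<zeta> + \<alpha> = \<beta>
  + \<xi> with \<alpha> and \<xi> in \<open>x\<close> determine an \<eta> in
  \<open>x\<close>.\<close>

lemma Gamma_diag_xy:
  assumes x: "x \<in> submodules B W" and a: "a \<in> submodules B W"
    and b: "b \<in> submodules B W" and z: "z \<in> submodules B W"
  shows "Gamma W x a x b z = (z <+>\<^bsub>W\<^esub> (x \<inter> a)) \<inter> (b <+>\<^bsub>W\<^esub> x)"
proof (intro equalityI subsetI)
  note sub = assms[THEN submodulesD(1), THEN subsetD]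
  fix \<omega> assume "\<omega> \<in> Gamma W x a x b z"
  then obtain \<alpha> \<eta> \<beta> where 1: "\<alpha> \<in> a" "\<eta> \<in> x" "\<beta> \<in> b" "\<alpha> \<oplus>\<^bsub>W\<^esub> \<eta> \<in> x" "\<eta> \<oplus>\<^bsub>W\<^esub> \<beta> \<in> z"
    and e: "\<omega> = \<alpha> \<oplus>\<^bsub>W\<^esub> \<eta> \<oplus>\<^bsub>W\<^esub> \<beta>"
    unfolding mem_Gamma_iff[OF x a x b z] by blast
  note c = 1(1)[THEN sub(2)] 1(2)[THEN sub(1)] 1(3)[THEN sub(3)]
  have "\<alpha> \<oplus>\<^bsub>W\<^esub> \<eta> \<oplus>\<^bsub>W\<^esub> \<ominus>\<^bsub>W\<^esub> \<eta> \<in> x"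
    using 1 submodulesD(3,4)[OF x] by blast
  then have "\<alpha> \<in> x"
    using c by (simp add: W.a_assoc W.r_neg)
  moreover have "\<omega> = (\<eta> \<oplus>\<^bsub>W\<^esub> \<beta>) \<oplus>\<^bsub>W\<^esub> \<alpha>" "\<omega> = \<beta> \<oplus>\<^bsub>W\<^esub> (\<alpha> \<oplus>\<^bsub>W\<^esub> \<eta>)"
    using c e by (simp_all add: W.a_ac)
  ultimately show "\<omega> \<in> (z <+>\<^bsub>W\<^esub> (x \<inter> a)) \<inter> (b <+>\<^bsub>W\<^esub> x)"
    using 1 unfolding Int_iff mem_set_add_iff by blast
next
  note sub = assms[THEN submodulesD(1), THEN subsetD]
  fix \<omega> assume "\<omega> \<in> (z <+>\<^bsub>W\<^esub> (x \<inter> a)) \<inter> (b <+>\<^bsub>W\<^esub> x)"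
  then obtain \<zeta> \<alpha> \<beta> \<xi> where 1: "\<zeta> \<in> z" "\<alpha> \<in> x" "\<alpha> \<in> a" "\<beta> \<in> b" "\<xi> \<in> x"
    and e: "\<omega> = \<zeta> \<oplus>\<^bsub>W\<^esub> \<alpha>" "\<omega> = \<beta> \<oplus>\<^bsub>W\<^esub> \<xi>"
    unfolding Int_iff mem_set_add_iff by blast
  note c = 1(1)[THEN sub(4)] 1(2)[THEN sub(1)] 1(4)[THEN sub(3)] 1(5)[THEN sub(1)]
  \<comment> \<open>The choice is forced by \<xi> = \<alpha> + \<eta>; it stays in \<open>x\<close>
    because \<alpha> and \<xi> do.\<close>
  define \<eta> where "\<eta> = \<ominus>\<^bsub>W\<^esub> \<alpha> \<oplus>\<^bsub>W\<^esub> \<xi>"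
  have \<eta>: "\<eta> \<in> x" "\<eta> \<in> carrier W"
    unfolding \<eta>_def using 1 c submodulesD(3,4)[OF x] by auto
  have \<xi>: "\<alpha> \<oplus>\<^bsub>W\<^esub> \<eta> = \<xi>"
    using c unfolding \<eta>_def by (simp add: W.r_neg2)
  then have \<omega>: "\<omega> = \<alpha> \<oplus>\<^bsub>W\<^esub> \<eta> \<oplus>\<^bsub>W\<^esub> \<beta>"
    using e c by (simp add: W.a_comm)
  then have "\<alpha> \<oplus>\<^bsub>W\<^esub> (\<eta> \<oplus>\<^bsub>W\<^esub> \<beta>) = \<alpha> \<oplus>\<^bsub>W\<^esub> \<zeta>"
    using e c \<eta> by (simp add: W.a_ac)
  then have "\<eta> \<oplus>\<^bsub>W\<^esub> \<beta> = \<zeta>"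
    using c \<eta> by simp
  then show "\<omega> \<in> Gamma W x a x b z"
    unfolding mem_Gamma_iff[OF x a x b z] using 1 \<eta> \<xi> \<omega> by blast
qed

text \<open>Once \<alpha> is in \<open>a\<close>, the condition that \<eta> + \<beta> lies in
  \<open>a\<close> says exactly that \<omega> = \<alpha> + (\<eta> + \<beta>) does. The rest is
  \<omega> = \<beta> + \<xi> with \<xi> = \<eta> + \<alpha> in \<open>x\<close> and in y +
  a.\<close>

lemma Gamma_diag_az:
  assumes x: "x \<in> submodules B W" and a: "a \<in> submodules B W"
    and y: "y \<in> submodules B W" and b: "b \<in> submodules B W"
  shows "Gamma W x a y b a = a \<inter> (b <+>\<^bsub>W\<^esub> (x \<inter> (y <+>\<^bsub>W\<^esub> a)))"
proof (intro equalityI subsetI)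
  note sub = assms[THEN submodulesD(1), THEN subsetD]
  fix \<omega> assume "\<omega> \<in> Gamma W x a y b a"
  then obtain \<alpha> \<eta> \<beta> where 1: "\<alpha> \<in> a" "\<eta> \<in> y" "\<beta> \<in> b" "\<alpha> \<oplus>\<^bsub>W\<^esub> \<eta> \<in> x" "\<eta> \<oplus>\<^bsub>W\<^esub> \<beta> \<in> a"
    and e: "\<omega> = \<alpha> \<oplus>\<^bsub>W\<^esub> \<eta> \<oplus>\<^bsub>W\<^esub> \<beta>"
    unfolding mem_Gamma_iff[OF x a y b a] by blast
  note c = 1(1)[THEN sub(2)] 1(2)[THEN sub(3)] 1(3)[THEN sub(4)]
  \<comment> \<open>The three regroupings place \<omega> in \<open>a\<close>, \<omega> in the sum of
    \<open>b\<close> and \<open>x\<close>, and \<xi> in y + a, in this order.\<close>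
  have "\<omega> = \<alpha> \<oplus>\<^bsub>W\<^esub> (\<eta> \<oplus>\<^bsub>W\<^esub> \<beta>)" "\<omega> = \<beta> \<oplus>\<^bsub>W\<^esub> (\<alpha> \<oplus>\<^bsub>W\<^esub> \<eta>)" "\<alpha> \<oplus>\<^bsub>W\<^esub> \<eta> = \<eta> \<oplus>\<^bsub>W\<^esub> \<alpha>"
    using c e by (simp_all add: W.a_ac)
  moreover from calculation have "\<omega> \<in> a" "\<alpha> \<oplus>\<^bsub>W\<^esub> \<eta> \<in> x \<inter> (y <+>\<^bsub>W\<^esub> a)"
    using 1 submodulesD(3)[OF a] unfolding Int_iff mem_set_add_iff by auto
  ultimately show "\<omega> \<in> a \<inter> (b <+>\<^bsub>W\<^esub> (x \<inter> (y <+>\<^bsub>W\<^esub> a)))"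
    \<comment> \<open>Instantiating at \<omega> opens only the outer intersection and sum; the inner
      ones stay folded and match the membership of \<alpha> + \<eta> just proved.\<close>
    using 1 unfolding Int_iff[of \<omega>] mem_set_add_iff[of \<omega>] by blast
next
  note sub = assms[THEN submodulesD(1), THEN subsetD]
  fix \<omega> assume "\<omega> \<in> a \<inter> (b <+>\<^bsub>W\<^esub> (x \<inter> (y <+>\<^bsub>W\<^esub> a)))"
  then obtain \<beta> \<eta> \<alpha> where 1: "\<omega> \<in> a" "\<beta> \<in> b" "\<eta> \<in> y" "\<alpha> \<in> a" "\<eta> \<oplus>\<^bsub>W\<^esub> \<alpha> \<in> x"
    and e: "\<omega> = \<beta> \<oplus>\<^bsub>W\<^esub> (\<eta> \<oplus>\<^bsub>W\<^esub> \<alpha>)"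
    unfolding Bex_def Int_iff mem_set_add_iff by blast
  note c = 1(1)[THEN sub(2)] 1(2)[THEN sub(4)] 1(3)[THEN sub(3)] 1(4)[THEN sub(2)]
  have *: "\<eta> \<oplus>\<^bsub>W\<^esub> \<alpha> = \<alpha> \<oplus>\<^bsub>W\<^esub> \<eta>" "\<omega> = \<alpha> \<oplus>\<^bsub>W\<^esub> \<eta> \<oplus>\<^bsub>W\<^esub> \<beta>" "\<omega> = \<alpha> \<oplus>\<^bsub>W\<^esub> (\<eta> \<oplus>\<^bsub>W\<^esub> \<beta>)"
    using c(2-4) e by (simp_all add: W.a_ac)
  \<comment> \<open>This element is \<eta> + \<beta>, the \<zeta> that has to lie in
    \<open>a\<close>.\<close>
  have "\<ominus>\<^bsub>W\<^esub> \<alpha> \<oplus>\<^bsub>W\<^esub> \<omega> \<in> a"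
    using 1 submodulesD(3,4)[OF a] by blast
  then have "\<eta> \<oplus>\<^bsub>W\<^esub> \<beta> \<in> a"
    using c(2-4) *(3) by (simp add: W.r_neg1)
  then show "\<omega> \<in> Gamma W x a y b a"
    unfolding mem_Gamma_iff[OF x a y b a] using 1 *(1,2) by metis
qed

text \<open>With \<beta> and \<eta> + \<beta> both in \<open>b\<close>, also \<eta> lies in
  \<open>b\<close>, so \<alpha> = (\<alpha> + \<eta>) - \<eta> is in the sum of \<open>x\<close> and
  y \<inter> b. Conversely, the part of \<alpha> in y \<inter> b supplies -\<eta>, and \<beta>
  compensates for it inside \<open>b\<close>.\<close>

lemma Gamma_diag_bz:
  assumes x: "x \<in> submodules B W" and a: "a \<in> submodules B W"
    and y: "y \<in> submodules B W" and b: "b \<in> submodules B W"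
  shows "Gamma W x a y b b = b <+>\<^bsub>W\<^esub> (a \<inter> (x <+>\<^bsub>W\<^esub> (y \<inter> b)))"
proof (intro equalityI subsetI)
  note sub = assms[THEN submodulesD(1), THEN subsetD]
  fix \<omega> assume "\<omega> \<in> Gamma W x a y b b"
  then obtain \<alpha> \<eta> \<beta> where 1: "\<alpha> \<in> a" "\<eta> \<in> y" "\<beta> \<in> b" "\<alpha> \<oplus>\<^bsub>W\<^esub> \<eta> \<in> x" "\<eta> \<oplus>\<^bsub>W\<^esub> \<beta> \<in> b"
    and e: "\<omega> = \<alpha> \<oplus>\<^bsub>W\<^esub> \<eta> \<oplus>\<^bsub>W\<^esub> \<beta>"
    unfolding mem_Gamma_iff[OF x a y b b] by blast
  note c = 1(1)[THEN sub(2)] 1(2)[THEN sub(3)] 1(3)[THEN sub(4)]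
  have "\<eta> \<oplus>\<^bsub>W\<^esub> \<beta> \<oplus>\<^bsub>W\<^esub> \<ominus>\<^bsub>W\<^esub> \<beta> \<in> b"
    using 1 submodulesD(3,4)[OF b] by blast
  then have "\<eta> \<in> b"
    using c by (simp add: W.a_assoc W.r_neg)
  then have "\<ominus>\<^bsub>W\<^esub> \<eta> \<in> y \<inter> b"
    using 1 submodulesD(4)[OF y] submodulesD(4)[OF b] by blast
  moreover have "\<alpha> = (\<alpha> \<oplus>\<^bsub>W\<^esub> \<eta>) \<oplus>\<^bsub>W\<^esub> \<ominus>\<^bsub>W\<^esub> \<eta>"
    using c by (simp add: W.a_assoc W.r_neg)
  ultimately have "\<alpha> \<in> x <+>\<^bsub>W\<^esub> (y \<inter> b)"
    using 1(4) unfolding mem_set_add_iff by blast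
  moreover have "\<omega> = (\<eta> \<oplus>\<^bsub>W\<^esub> \<beta>) \<oplus>\<^bsub>W\<^esub> \<alpha>"
    using c e by (simp add: W.a_ac)
  ultimately show "\<omega> \<in> b <+>\<^bsub>W\<^esub> (a \<inter> (x <+>\<^bsub>W\<^esub> (y \<inter> b)))"
    using 1 unfolding mem_set_add_iff[of \<omega>] by blast
next
  note sub = assms[THEN submodulesD(1), THEN subsetD]
  fix \<omega> assume "\<omega> \<in> b <+>\<^bsub>W\<^esub> (a \<inter> (x <+>\<^bsub>W\<^esub> (y \<inter> b)))"
  then obtain \<zeta> \<alpha> \<xi> \<theta> where 1: "\<zeta> \<in> b" "\<alpha> \<in> a" "\<xi> \<in> x" "\<theta> \<in> y" "\<theta> \<in> b"
    and e: "\<omega> = \<zeta> \<oplus>\<^bsub>W\<^esub> \<alpha>" "\<alpha> = \<xi> \<oplus>\<^bsub>W\<^esub> \<theta>"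
    unfolding Bex_def Int_iff mem_set_add_iff by blast
  note c = 1(1)[THEN sub(4)] 1(2)[THEN sub(2)] 1(3)[THEN sub(1)] 1(4)[THEN sub(3)]
  \<comment> \<open>The witnesses are \<eta> = -\<theta> and \<beta> = \<theta> + \<zeta>: then
    \<alpha> + \<eta> = \<xi> and \<eta> + \<beta> = \<zeta>. Membership of \<beta> in
    \<open>b\<close> uses that \<theta> lies in \<open>b\<close> as well as in
    \<open>y\<close>.\<close>
  have neg: "\<ominus>\<^bsub>W\<^esub> \<theta> \<in> y" and add: "\<theta> \<oplus>\<^bsub>W\<^esub> \<zeta> \<in> b"
    using 1 submodulesD(4)[OF y] submodulesD(3)[OF b] by blast+
  have "\<alpha> \<oplus>\<^bsub>W\<^esub> \<ominus>\<^bsub>W\<^esub> \<theta> = \<xi>"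
    using c e by (simp add: W.a_assoc W.r_neg)
  moreover have \<zeta>: "\<ominus>\<^bsub>W\<^esub> \<theta> \<oplus>\<^bsub>W\<^esub> (\<theta> \<oplus>\<^bsub>W\<^esub> \<zeta>) = \<zeta>"
    using c by (simp add: W.r_neg1)
  moreover have "\<omega> = \<alpha> \<oplus>\<^bsub>W\<^esub> \<ominus>\<^bsub>W\<^esub> \<theta> \<oplus>\<^bsub>W\<^esub> (\<theta> \<oplus>\<^bsub>W\<^esub> \<zeta>)"
    using c e(1) \<zeta> by (simp add: W.a_assoc W.a_comm[of \<zeta> \<alpha>])
  ultimately show "\<omega> \<in> Gamma W x a y b b"
    unfolding mem_Gamma_iff[OF x a y b b] using 1 neg add by metis
qed

section \<open>Special cases by absorption\<close>

lemma Gamma_diag_xy_cases: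
  assumes x: "x \<in> submodules B W" and a: "a \<in> submodules B W"
    and b: "b \<in> submodules B W" and z: "z \<in> submodules B W"
  shows "Gamma W x a x b x = x"
    and "Gamma W x x x b z = (z <+>\<^bsub>W\<^esub> x) \<inter> (b <+>\<^bsub>W\<^esub> x)"
    and "Gamma W x x x z z = z <+>\<^bsub>W\<^esub> x"
    and "Gamma W x a x x z = (z <+>\<^bsub>W\<^esub> (x \<inter> a)) \<inter> x"
    and "Gamma W x a x x a = a \<inter> x"
    and "Gamma W x a x b a = a \<inter> (b <+>\<^bsub>W\<^esub> x)"
    and "Gamma W x a x a z = (z <+>\<^bsub>W\<^esub> (x \<inter> a)) \<inter> (x <+>\<^bsub>W\<^esub> a)"
    and "Gamma W x a x z z = z <+>\<^bsub>W\<^esub> (x \<inter> a)"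
proof -
  have xa: "x \<inter> a \<in> submodules B W"
    using x a by (rule submodules_Int)
  \<comment> \<open>For z = x the first factor x + (x \<inter> a) collapses to \<open>x\<close>, and
    this inclusion removes the second factor.\<close>
  have "x \<subseteq> b <+>\<^bsub>W\<^esub> x"
    using subset_set_add_left[OF x b] set_add_commute[OF x b] by simp
  then show "Gamma W x a x b x = x"
    using x a b xa by (auto simp: Gamma_diag_xy set_add_absorb)
  show "Gamma W x x x b z = (z <+>\<^bsub>W\<^esub> x) \<inter> (b <+>\<^bsub>W\<^esub> x)"
    using x b z by (simp add: Gamma_diag_xy)
  show "Gamma W x x x z z = z <+>\<^bsub>W\<^esub> x"
    using x z by (simp add: Gamma_diag_xy)
  show "Gamma W x a x x z = (z <+>\<^bsub>W\<^esub> (x \<inter> a)) \<inter> x"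
    using x a z by (simp add: Gamma_diag_xy set_add_absorb)
  \<comment> \<open>Two absorptions act here: a + (x \<inter> a) = a from z = a, and x + x = x from
    b = x.\<close>
  show "Gamma W x a x x a = a \<inter> x"
    using x a xa by (simp add: Gamma_diag_xy set_add_absorb)
  show "Gamma W x a x b a = a \<inter> (b <+>\<^bsub>W\<^esub> x)"
    using x a b xa by (simp add: Gamma_diag_xy set_add_absorb)
  show "Gamma W x a x a z = (z <+>\<^bsub>W\<^esub> (x \<inter> a)) \<inter> (x <+>\<^bsub>W\<^esub> a)"
    using x a z by (simp add: Gamma_diag_xy set_add_commute)
  \<comment> \<open>For b = z the second factor is z + x, which contains the first one.\<close>
  have "z <+>\<^bsub>W\<^esub> (x \<inter> a) \<subseteq> z <+>\<^bsub>W\<^esub> x"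
    by (rule set_add_mono) auto
  then show "Gamma W x a x z z = z <+>\<^bsub>W\<^esub> (x \<inter> a)"
    using x a z by (auto simp: Gamma_diag_xy)
qed

text \<open>Putting b = x turns the inner sum into x + (x \<inter> (y + a)), which is
  \<open>x\<close>; this is why \<open>y\<close> drops out.\<close>

lemma Gamma_diag_az_xb:
  assumes x: "x \<in> submodules B W" and a: "a \<in> submodules B W" and y: "y \<in> submodules B W"
  shows "Gamma W x a y x a = a \<inter> x"
  using assms by (simp add: Gamma_diag_az set_add_absorb submodules_Int submodules_set_add)

text \<open>Putting x = a makes the inner sum a + (y \<inter> b) contain \<open>a\<close>, so its
  intersection with \<open>a\<close> is \<open>a\<close>.\<close>

lemma Gamma_diag_bz_xa:
  assumes a: "a \<in> submodules B W" and y: "y \<in> submodules B W" and b: "b \<in> submodules B W"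
  shows "Gamma W a a y b b = b <+>\<^bsub>W\<^esub> a"
proof -
  have "a \<inter> (a <+>\<^bsub>W\<^esub> (y \<inter> b)) = a"
    using subset_set_add_left[OF a submodules_Int[OF y b]] by blast
  then show ?thesis
    using assms by (simp add: Gamma_diag_bz)
qed

text \<open>Putting b = a adds to \<open>a\<close> a submodule of \<open>a\<close>, which is
  absorbed.\<close>

lemma Gamma_diag_bz_ab:
  assumes x: "x \<in> submodules B W" and a: "a \<in> submodules B W" and y: "y \<in> submodules B W"
  shows "Gamma W x a y a a = a"
  using assms by (simp add: Gamma_diag_bz set_add_absorb submodules_Int submodules_set_add)

end

theorem theorem2p4:
  fixes K :: "('k, 'l) ring_scheme" and B :: "('k, 'b, 'm) module_scheme"
    and W :: "('b, 'w, 'n) module_scheme"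
  assumes "associative_algebra K B" and "right_module B W"
  shows
    "(\<forall>x\<in>submodules B W. \<forall>a\<in>submodules B W. \<forall>b\<in>submodules B W. \<forall>z\<in>submodules B W.
        Gamma W x a x b z = (z <+>\<^bsub>W\<^esub> (x \<inter> a)) \<inter> (b <+>\<^bsub>W\<^esub> x) \<and>
        Gamma W x a x b x = x \<and>
        Gamma W x x x b z = (z <+>\<^bsub>W\<^esub> x) \<inter> (b <+>\<^bsub>W\<^esub> x) \<and>
        Gamma W x x x z z = z <+>\<^bsub>W\<^esub> x \<and>
        Gamma W x a x x z = (z <+>\<^bsub>W\<^esub> (x \<inter> a)) \<inter> x \<and>
        Gamma W x a x x a = a \<inter> x \<and>
        Gamma W x a x b a = a \<inter> (b <+>\<^bsub>W\<^esub> x) \<and>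
        Gamma W x a x a z = (z <+>\<^bsub>W\<^esub> (x \<inter> a)) \<inter> (x <+>\<^bsub>W\<^esub> a) \<and>
        Gamma W x a x z z = z <+>\<^bsub>W\<^esub> (x \<inter> a)) \<and>
     (\<forall>x\<in>submodules B W. \<forall>a\<in>submodules B W. \<forall>y\<in>submodules B W. \<forall>b\<in>submodules B W.
        Gamma W x a y b a = a \<inter> (b <+>\<^bsub>W\<^esub> (x \<inter> (y <+>\<^bsub>W\<^esub> a)))) \<and>
     (\<forall>x\<in>submodules B W. \<forall>a\<in>submodules B W. \<forall>y\<in>submodules B W.
        Gamma W x a y x a = a \<inter> x) \<and>
     (\<forall>x\<in>submodules B W. \<forall>a\<in>submodules B W. \<forall>y\<in>submodules B W. \<forall>b\<in>submodules B W.
        Gamma W x a y b b = b <+>\<^bsub>W\<^esub> (a \<inter> (x <+>\<^bsub>W\<^esub> (y \<inter> b)))) \<and>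
     (\<forall>a\<in>submodules B W. \<forall>y\<in>submodules B W. \<forall>b\<in>submodules B W.
        Gamma W a a y b b = b <+>\<^bsub>W\<^esub> a) \<and>
     (\<forall>x\<in>submodules B W. \<forall>a\<in>submodules B W. \<forall>y\<in>submodules B W.
        Gamma W x a y a a = a)"
proof -
  interpret right_module B W by fact
  show ?thesis
    \<comment> \<open>The bounded quantifiers become the membership assumptions that discharge the
      premises of each rule.\<close>
    by (intro conjI ballI)
      (rule Gamma_diag_xy Gamma_diag_xy_cases Gamma_diag_az Gamma_diag_az_xb
        Gamma_diag_bz Gamma_diag_bz_xa Gamma_diag_bz_ab; assumption)+
qed

end
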